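(* Let $(Q,\cdot)$ be a $\sigma$-generalised Bol loop with identity $e$ in which $\sigma(x^{-1})=(\sigma(x))^{-1}$ and $xy\cdot\sigma(x)=x\cdot y\sigma(x)$ for all $x,y\in Q$. Let $\alpha\in BS(Q,\cdot)$ with $\alpha=\psi R_x^{-1}$, where $x\in Q$ and $\psi\in SYM(Q)$ satisfies $e\psi=e$. Then there is some $g\in Q$ such that $\psi$ is a pseudo-automorphism of $(Q,\cdot)$ with companion $x^{-1}g^{-1}\cdot(\sigma(x))^{-1}$. Moreover $\psi$ is unique: if also $\alpha=\psi'R_{x'}^{-1}$ with $x'\in Q$, $\psi'\in SYM(Q)$ and $e\psi'=e$, then $\psi'=\psi$.
   Context: Juxtaposition binds more tightly than $\cdot$. Mappings are written on the right of their arguments and composed left to right; $yL_x=x\cdot y$, $yR_x=y\cdot x$. $SYM(Q)$ is the group of all permutations of $Q$. A loop $(Q,\cdot)$ with self-map $\sigma:Q\to Q$ (an arbitrary function) is a $\sigma$-generalised (right) Bol loop if $(xy\cdot z)\sigma(y)=x(yz\cdot\sigma(y))$ for all $x,y,z\in Q$. In such a loop left and right inverses coincide, and $x^{-1}$ denotes the two-sided inverse of $x$. A triple $(A,B,C)$ of bijections of $Q$ is in $AUT(Q,\cdot)$ (an autotopism) if $xA\cdot yB=(x\cdot y)C$ for all $x,y\in Q$. A bijection $A$ is a pseudo-automorphism with companion $c\in Q$ if $(A,AR_c,AR_c)\in AUT(Q,\cdot)$. The Bryant-Schneider group is $BS(Q,\cdot)=\{\theta\in SYM(Q) : \exists f,g\in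 Q \text{ with } (\theta R_g^{-1},\theta L_f^{-1},\theta)\in AUT(Q,\cdot)\}$. *)

theory Defs
  imports "HOL-Algebra.Bij"
begin

locale loop =
  fixes Q (structure)
  assumes m_closed: "\<lbrakk>x \<in> carrier Q; y \<in> carrier Q\<rbrakk> \<Longrightarrow> x \<otimes> y \<in> carrier Q"
    and one_closed: "\<one> \<in> carrier Q"
    and l_one: "x \<in> carrier Q \<Longrightarrow> \<one> \<otimes> x = x"
    and r_one: "x \<in> carrier Q \<Longrightarrow> x \<otimes> \<one> = x"
    and ex1_right_factor:
      "\<lbrakk>a \<in> carrier Q; b \<in> carrier Q\<rbrakk> \<Longrightarrow> \<exists>!x. x \<in> carrier Q \<and> a \<otimes> x = b"
    and ex1_left_factor:
      "\<lbrakk>a \<in> carrier Q; b \<in> carrier Q\<rbrakk> \<Longrightarrow> \<exists>!y. y \<in> carrier Q \<and> y \<otimes> a = b"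

locale gen_bol_loop = loop +
  fixes \<sigma> :: "'a \<Rightarrow> 'a"
  assumes sigma_closed: "x \<in> carrier Q \<Longrightarrow> \<sigma> x \<in> carrier Q"
    and gen_bol: "\<lbrakk>x \<in> carrier Q; y \<in> carrier Q; z \<in> carrier Q\<rbrakk> \<Longrightarrow>
      ((x \<otimes> y) \<otimes> z) \<otimes> \<sigma> y = x \<otimes> ((y \<otimes> z) \<otimes> \<sigma> y)"

text \<open>
  The inverse \<^const>\<open>m_inv\<close> is a definite description of a two-sided inverse. No
  associativity is available to justify it, but the Bol law makes it well defined.
\<close>

lemma (in gen_bol_loop) ex1_two_sided_inverse:
  assumes y: "y \<in> carrier Q"
  shows "\<exists>!z. z \<in> carrier Q \<and> y \<otimes> z = \<one> \<and> z \<otimes> y = \<one>"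
proof -
  obtain z where z: "z \<in> carrier Q" "y \<otimes> z = \<one>"
    using ex1_right_factor[OF y one_closed] by blast
  obtain w where w: "w \<in> carrier Q" "w \<otimes> y = \<one>"
    using ex1_left_factor[OF y one_closed] by blast
  have s: "\<sigma> y \<in> carrier Q" by (rule sigma_closed[OF y])
  have "z \<otimes> \<sigma> y = w \<otimes> \<sigma> y"
    using gen_bol[OF w(1) y z(1)] z w s by (simp add: l_one)
  then have "z = w"
    using ex1_left_factor[OF s m_closed[OF w(1) s]] z(1) w(1) by blast
  then show ?thesis
    using z w ex1_right_factor[OF y one_closed] by blast
qed

text \<open>
  The symmetric group is \<^const>\<open>BijGroup\<close>, whose elements are extensional functions, so
  that equality of permutations is equality on the carrier. Its product \<open>f \<otimes> g\<close> applies
  \<open>g\<close> first; with mappings written on the right, the composite \<open>AB\<close> is therefore \<open>B \<otimes> A\<close>.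
\<close>

abbreviation SYM :: "('a, 'm) monoid_scheme \<Rightarrow> ('a \<Rightarrow> 'a) monoid" where
  "SYM Q \<equiv> BijGroup (carrier Q)"

definition lmul :: "('a, 'm) monoid_scheme \<Rightarrow> 'a \<Rightarrow> 'a \<Rightarrow> 'a" where
  "lmul Q x = (\<lambda>y\<in>carrier Q. x \<otimes>\<^bsub>Q\<^esub> y)"

definition rmul :: "('a, 'm) monoid_scheme \<Rightarrow> 'a \<Rightarrow> 'a \<Rightarrow> 'a" where
  "rmul Q x = (\<lambda>y\<in>carrier Q. y \<otimes>\<^bsub>Q\<^esub> x)"

definition AUT :: "('a, 'm) monoid_scheme \<Rightarrow> (('a \<Rightarrow> 'a) \<times> ('a \<Rightarrow> 'a) \<times> ('a \<Rightarrow> 'a)) set" where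
  "AUT Q = {(A, B, C). A \<in> carrier (SYM Q) \<and> B \<in> carrier (SYM Q) \<and> C \<in> carrier (SYM Q) \<and>
     (\<forall>x\<in>carrier Q. \<forall>y\<in>carrier Q. A x \<otimes>\<^bsub>Q\<^esub> B y = C (x \<otimes>\<^bsub>Q\<^esub> y))}"

definition pseudo_automorphism :: "('a, 'm) monoid_scheme \<Rightarrow> ('a \<Rightarrow> 'a) \<Rightarrow> 'a \<Rightarrow> bool" where
  "pseudo_automorphism Q A c \<longleftrightarrow> A \<in> carrier (SYM Q) \<and> c \<in> carrier Q \<and>
     (A, rmul Q c \<otimes>\<^bsub>SYM Q\<^esub> A, rmul Q c \<otimes>\<^bsub>SYM Q\<^esub> A) \<in> AUT Q"

definition BS :: "('a, 'm) monoid_scheme \<Rightarrow> ('a \<Rightarrow> 'a) set" where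
  "BS Q = {\<theta> \<in> carrier (SYM Q). \<exists>f\<in>carrier Q. \<exists>g\<in>carrier Q.
     (inv\<^bsub>SYM Q\<^esub> (rmul Q g) \<otimes>\<^bsub>SYM Q\<^esub> \<theta>, inv\<^bsub>SYM Q\<^esub> (lmul Q f) \<otimes>\<^bsub>SYM Q\<^esub> \<theta>, \<theta>) \<in> AUT Q}"

end

theory Submission
  imports Defs
begin

text \<open>
  The generalised Bol law says precisely that
  \<open>(R\<^sub>y\<^sup>-\<^sup>1, L\<^sub>y R\<^bsub>\<sigma> y\<^esub>, R\<^bsub>\<sigma> y\<^esub>)\<close> is an autotopism for every \<open>y\<close> (products are read
  from left to right here). It also yields the right inverse property, so right translations are
  inverted by \<open>R\<^sub>y\<^sup>-\<^sup>1 = R\<^bsub>inv y\<^esub>\<close>, and replacing \<open>y\<close> by \<open>inv y\<close> gives autotopisms whose first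
  component is \<open>R\<^sub>y\<close> itself.

  Membership of \<open>\<alpha> = \<psi> R\<^sub>x\<^sup>-\<^sup>1\<close> in the Bryant-Schneider group provides an autotopism whose first
  component is \<open>\<psi> R\<^sub>x\<^sup>-\<^sup>1 R\<^sub>g\<^sup>-\<^sup>1\<close>. Multiplying by the Bol autotopisms with first components \<open>R\<^sub>g\<close> and
  \<open>R\<^sub>x\<close> cancels both translations and leaves an autotopism \<open>(\<psi>, B, C)\<close>, where
  \<open>C = \<psi> R\<^bsub>inv x\<^esub> R\<^bsub>\<sigma> (inv g)\<^esub> R\<^bsub>\<sigma> (inv x)\<^esub>\<close>. Since \<open>\<psi>\<close> fixes \<open>\<one>\<close>, this autotopism is forced to have
  the shape \<open>(\<psi>, \<psi> R\<^sub>c, \<psi> R\<^sub>c)\<close> with \<open>c\<close> the image of \<open>\<one>\<close> under \<open>C\<close>. Evaluating \<open>C\<close> there gives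
  the companion, with \<open>\<sigma> g\<close> in the place of the element called \<open>g\<close> in the conclusion.

  Uniqueness holds because \<open>\<alpha> \<one>\<close> is the left inverse of \<open>x\<close>, so that \<open>\<alpha>\<close> determines \<open>x\<close> and
  hence \<open>\<psi>\<close>.
\<close>

lemma SYM_mult_apply:
  assumes "f \<in> carrier (SYM Q)" "h \<in> carrier (SYM Q)" "a \<in> carrier Q"
  shows "(f \<otimes>\<^bsub>SYM Q\<^esub> h) a = f (h a)"
  using assms by (simp add: BijGroup_def compose_def)

lemma SYM_apply_closed:
  assumes "f \<in> carrier (SYM Q)" "a \<in> carrier Q"
  shows "f a \<in> carrier Q"
  using assms by (auto simp: BijGroup_def Bij_def bij_betw_def)

lemma SYM_eqI:
  assumes "f \<in> carrier (SYM Q)" "h \<in> carrier (SYM Q)"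
    and "\<And>a. a \<in> carrier Q \<Longrightarrow> f a = h a"
  shows "f = h"
  using assms by (auto simp: BijGroup_def Bij_def intro: extensionalityI)

context loop
begin

lemma left_cancel:
  assumes "a \<in> carrier Q" "b \<in> carrier Q" "c \<in> carrier Q" "a \<otimes> b = a \<otimes> c"
  shows "b = c"
  using ex1_right_factor[of a "a \<otimes> c"] m_closed assms by blast

lemma right_cancel:
  assumes "a \<in> carrier Q" "b \<in> carrier Q" "c \<in> carrier Q" "b \<otimes> a = c \<otimes> a"
  shows "b = c"
  using ex1_left_factor[of a "c \<otimes> a"] m_closed assms by blast

lemma AUT_mult:
  assumes "(A, B, C) \<in> AUT Q" "(A', B', C') \<in> AUT Q"
  shows "(A' \<otimes>\<^bsub>SYM Q\<^esub> A, B' \<otimes>\<^bsub>SYM Q\<^esub> B, C' \<otimes>\<^bsub>SYM Q\<^esub> C) \<in> AUT Q"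
proof -
  interpret S: group "SYM Q" by (rule group_BijGroup)
  have A: "A \<in> carrier (SYM Q)" "B \<in> carrier (SYM Q)" "C \<in> carrier (SYM Q)"
    and A': "A' \<in> carrier (SYM Q)" "B' \<in> carrier (SYM Q)" "C' \<in> carrier (SYM Q)"
    and T: "\<And>a b. \<lbrakk>a \<in> carrier Q; b \<in> carrier Q\<rbrakk> \<Longrightarrow> A a \<otimes> B b = C (a \<otimes> b)"
    and T': "\<And>a b. \<lbrakk>a \<in> carrier Q; b \<in> carrier Q\<rbrakk> \<Longrightarrow> A' a \<otimes> B' b = C' (a \<otimes> b)"
    using assms by (auto simp: AUT_def)
  have "(A' \<otimes>\<^bsub>SYM Q\<^esub> A) a \<otimes> (B' \<otimes>\<^bsub>SYM Q\<^esub> B) b = (C' \<otimes>\<^bsub>SYM Q\<^esub> C) (a \<otimes> b)"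
    if a: "a \<in> carrier Q" and b: "b \<in> carrier Q" for a b
    using T'[OF SYM_apply_closed[OF A(1) a] SYM_apply_closed[OF A(2) b]] T[OF a b]
    by (simp add: SYM_mult_apply[OF A'(1) A(1) a] SYM_mult_apply[OF A'(2) A(2) b]
        SYM_mult_apply[OF A'(3) A(3) m_closed[OF a b]])
  then show ?thesis
    using A A' by (simp add: AUT_def)
qed

lemma rmul_in_SYM:
  assumes a: "a \<in> carrier Q"
  shows "rmul Q a \<in> carrier (SYM Q)"
proof -
  have "bij_betw (rmul Q a) (carrier Q) (carrier Q)"
  proof (rule bij_betw_imageI)
    show "inj_on (rmul Q a) (carrier Q)"
      using right_cancel[OF a] by (auto simp: inj_on_def rmul_def)
    have "b \<in> rmul Q a ` carrier Q" if b: "b \<in> carrier Q" for b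
    proof -
      obtain d where "d \<in> carrier Q" "d \<otimes> a = b"
        using ex1_left_factor[OF a b] by blast
      then show ?thesis by (intro image_eqI[of _ _ d]) (simp_all add: rmul_def)
    qed
    then show "rmul Q a ` carrier Q = carrier Q"
      using m_closed a by (auto simp: rmul_def)
  qed
  then show ?thesis by (simp add: BijGroup_def Bij_def rmul_def)
qed

lemma lmul_in_SYM:
  assumes a: "a \<in> carrier Q"
  shows "lmul Q a \<in> carrier (SYM Q)"
proof -
  have "bij_betw (lmul Q a) (carrier Q) (carrier Q)"
  proof (rule bij_betw_imageI)
    show "inj_on (lmul Q a) (carrier Q)"
      using left_cancel[OF a] by (auto simp: inj_on_def lmul_def)
    have "b \<in> lmul Q a ` carrier Q" if b: "b \<in> carrier Q" for b
    proof -
      obtain d where "d \<in> carrier Q" "a \<otimes> d = b"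
        using ex1_right_factor[OF a b] by blast
      then show ?thesis by (intro image_eqI[of _ _ d]) (simp_all add: lmul_def)
    qed
    then show "lmul Q a ` carrier Q = carrier Q"
      using m_closed a by (auto simp: lmul_def)
  qed
  then show ?thesis by (simp add: BijGroup_def Bij_def lmul_def)
qed

lemma rmul_apply: "a \<in> carrier Q \<Longrightarrow> rmul Q c a = a \<otimes> c"
  by (simp add: rmul_def)

lemma lmul_apply: "a \<in> carrier Q \<Longrightarrow> lmul Q c a = c \<otimes> a"
  by (simp add: lmul_def)

text \<open>
  Putting \<open>\<one>\<close> for the first argument of \<open>A a \<otimes> B b = C (a \<otimes> b)\<close> gives \<open>B = C\<close>, and putting
  \<open>\<one>\<close> for the second then gives \<open>C a = A a \<otimes> C \<one>\<close>.
\<close>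

lemma autotopism_fixing_one_is_pseudo_automorphism:
  assumes T: "(A, B, C) \<in> AUT Q" and A1: "A \<one> = \<one>"
  shows "pseudo_automorphism Q A (C \<one>)"
proof -
  interpret S: group "SYM Q" by (rule group_BijGroup)
  have A: "A \<in> carrier (SYM Q)" and B: "B \<in> carrier (SYM Q)" and C: "C \<in> carrier (SYM Q)"
    and hom: "\<And>a b. \<lbrakk>a \<in> carrier Q; b \<in> carrier Q\<rbrakk> \<Longrightarrow> A a \<otimes> B b = C (a \<otimes> b)"
    using T by (auto simp: AUT_def)
  have c: "C \<one> \<in> carrier Q"
    by (rule SYM_apply_closed[OF C one_closed])
  have BC: "B b = C b" if b: "b \<in> carrier Q" for b
    using hom[OF one_closed b] by (simp add: A1 l_one b SYM_apply_closed[OF B b])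
  have "B = C"
    by (rule SYM_eqI[OF B C BC])
  moreover have "C = rmul Q (C \<one>) \<otimes>\<^bsub>SYM Q\<^esub> A"
  proof (rule SYM_eqI[OF C])
    show "rmul Q (C \<one>) \<otimes>\<^bsub>SYM Q\<^esub> A \<in> carrier (SYM Q)"
      using rmul_in_SYM[OF c] A by simp
    fix a assume a: "a \<in> carrier Q"
    show "C a = (rmul Q (C \<one>) \<otimes>\<^bsub>SYM Q\<^esub> A) a"
      using hom[OF a one_closed] a
      by (simp add: SYM_mult_apply[OF rmul_in_SYM[OF c] A] rmul_apply SYM_apply_closed[OF A]
          BC one_closed r_one)
  qed
  ultimately show ?thesis
    using T A c by (simp add: pseudo_automorphism_def)
qed

text \<open>
  The element \<open>u = \<alpha> \<one>\<close> satisfies \<open>u \<otimes> x = \<psi> \<one> = \<one>\<close>, and this equation can be solved for \<open>x\<close>.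
\<close>

lemma translation_factorisation_unique:
  assumes x: "x \<in> carrier Q" and y: "y \<in> carrier Q"
    and \<psi>: "\<psi> \<in> carrier (SYM Q)" and \<phi>: "\<phi> \<in> carrier (SYM Q)"
    and "\<psi> \<one> = \<one>" "\<phi> \<one> = \<one>"
    and eq: "inv\<^bsub>SYM Q\<^esub> (rmul Q x) \<otimes>\<^bsub>SYM Q\<^esub> \<psi> = inv\<^bsub>SYM Q\<^esub> (rmul Q y) \<otimes>\<^bsub>SYM Q\<^esub> \<phi>"
  shows "\<phi> = \<psi>"
proof -
  interpret S: group "SYM Q" by (rule group_BijGroup)
  define \<alpha> where "\<alpha> = inv\<^bsub>SYM Q\<^esub> (rmul Q x) \<otimes>\<^bsub>SYM Q\<^esub> \<psi>"
  note Rx = rmul_in_SYM[OF x] and Ry = rmul_in_SYM[OF y]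
  have \<alpha>: "\<alpha> \<in> carrier (SYM Q)"
    unfolding \<alpha>_def using Rx \<psi> by simp
  have \<psi>_eq: "\<psi> = rmul Q x \<otimes>\<^bsub>SYM Q\<^esub> \<alpha>"
    unfolding \<alpha>_def using Rx \<psi> by (simp add: S.m_assoc[symmetric])
  have \<phi>_eq: "\<phi> = rmul Q y \<otimes>\<^bsub>SYM Q\<^esub> \<alpha>"
    unfolding \<alpha>_def eq using Ry \<phi> by (simp add: S.m_assoc[symmetric])
  have u: "\<alpha> \<one> \<in> carrier Q"
    by (rule SYM_apply_closed[OF \<alpha> one_closed])
  have "\<psi> \<one> = \<alpha> \<one> \<otimes> x"
    unfolding \<psi>_eq by (simp add: SYM_mult_apply[OF Rx \<alpha> one_closed] rmul_apply[OF u])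
  moreover have "\<phi> \<one> = \<alpha> \<one> \<otimes> y"
    unfolding \<phi>_eq by (simp add: SYM_mult_apply[OF Ry \<alpha> one_closed] rmul_apply[OF u])
  ultimately have "x = y"
    using left_cancel[OF u x y] assms(5,6) by simp
  then show ?thesis using \<psi>_eq \<phi>_eq by simp
qed

end

context gen_bol_loop
begin

lemma two_sided_inverse:
  assumes "y \<in> carrier Q"
  shows inv_closed: "inv y \<in> carrier Q" and right_inv: "y \<otimes> inv y = \<one>"
    and left_inv: "inv y \<otimes> y = \<one>"
  using theI'[OF ex1_two_sided_inverse[OF assms]] by (auto simp: m_inv_def)

text \<open>The Bol law at \<open>z = inv y\<close>, after cancelling \<open>\<sigma> y\<close> on the right.\<close>

lemma right_inverse_property:
  assumes p: "p \<in> carrier Q" and y: "y \<in> carrier Q"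
  shows "(p \<otimes> y) \<otimes> inv y = p"
proof (rule right_cancel[OF sigma_closed[OF y]])
  show "((p \<otimes> y) \<otimes> inv y) \<otimes> \<sigma> y = p \<otimes> \<sigma> y"
    using gen_bol[OF p y inv_closed[OF y]] y by (simp add: right_inv l_one sigma_closed)
qed (use p y in \<open>simp_all add: m_closed inv_closed\<close>)

lemma inv_rmul:
  assumes y: "y \<in> carrier Q"
  shows "inv\<^bsub>SYM Q\<^esub> (rmul Q y) = rmul Q (inv y)"
proof -
  interpret S: group "SYM Q" by (rule group_BijGroup)
  note R = rmul_in_SYM[OF y] and R' = rmul_in_SYM[OF inv_closed[OF y]]
  have "rmul Q (inv y) \<otimes>\<^bsub>SYM Q\<^esub> rmul Q y = \<one>\<^bsub>SYM Q\<^esub>"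
  proof (rule SYM_eqI)
    fix a assume a: "a \<in> carrier Q"
    then show "(rmul Q (inv y) \<otimes>\<^bsub>SYM Q\<^esub> rmul Q y) a = \<one>\<^bsub>SYM Q\<^esub> a"
      using y by (simp add: SYM_mult_apply[OF R' R] rmul_apply m_closed right_inverse_property)
        (simp add: BijGroup_def)
  qed (use R R' in simp_all)
  then show ?thesis using R R' by (simp add: S.inv_equality)
qed

text \<open>
  This is the Bol law for the parameter \<open>inv y\<close> in the form that cancels a factor \<open>R\<^sub>y\<^sup>-\<^sup>1\<close> in the
  first component of an autotopism.
\<close>

lemma bol_autotopism:
  assumes y: "y \<in> carrier Q"
  shows "(rmul Q y, rmul Q (\<sigma> (inv y)) \<otimes>\<^bsub>SYM Q\<^esub> lmul Q (inv y), rmul Q (\<sigma> (inv y))) \<in> AUT Q"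
proof -
  interpret S: group "SYM Q" by (rule group_BijGroup)
  note y' = inv_closed[OF y]
  note s = sigma_closed[OF y']
  note R = rmul_in_SYM[OF s] and L = lmul_in_SYM[OF y']
  have "(p \<otimes> y) \<otimes> ((inv y \<otimes> q) \<otimes> \<sigma> (inv y)) = (p \<otimes> q) \<otimes> \<sigma> (inv y)"
    if p: "p \<in> carrier Q" and q: "q \<in> carrier Q" for p q
    using gen_bol[OF m_closed[OF p y] y' q] by (simp add: right_inverse_property p y)
  then show ?thesis
    using rmul_in_SYM[OF y] R L y y' s
    by (simp add: AUT_def SYM_mult_apply[OF R L] rmul_apply lmul_apply m_closed)
qed

end

theorem theorem3p6:
  fixes Q :: "('a, 'm) monoid_scheme" (structure)
    and \<sigma> :: "'a \<Rightarrow> 'a"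
    and \<alpha> \<psi> :: "'a \<Rightarrow> 'a"
    and x :: 'a
  assumes "gen_bol_loop Q \<sigma>"
    and "\<And>x. x \<in> carrier Q \<Longrightarrow> \<sigma> (inv x) = inv (\<sigma> x)"
    and "\<And>x y. \<lbrakk>x \<in> carrier Q; y \<in> carrier Q\<rbrakk> \<Longrightarrow> (x \<otimes> y) \<otimes> \<sigma> x = x \<otimes> (y \<otimes> \<sigma> x)"
    and "\<alpha> \<in> BS Q"
    and "x \<in> carrier Q"
    and "\<psi> \<in> carrier (SYM Q)"
    and "\<psi> \<one> = \<one>"
    and "\<alpha> = inv\<^bsub>SYM Q\<^esub> (rmul Q x) \<otimes>\<^bsub>SYM Q\<^esub> \<psi>"
  shows "(\<exists>g\<in>carrier Q. pseudo_automorphism Q \<psi> ((inv x \<otimes> inv g) \<otimes> inv (\<sigma> x))) \<and>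
    (\<forall>x'\<in>carrier Q. \<forall>\<psi>'\<in>carrier (SYM Q).
      \<psi>' \<one> = \<one> \<longrightarrow> \<alpha> = inv\<^bsub>SYM Q\<^esub> (rmul Q x') \<otimes>\<^bsub>SYM Q\<^esub> \<psi>' \<longrightarrow> \<psi>' = \<psi>)"
proof -
  interpret gen_bol_loop Q \<sigma> by (rule assms(1))
  interpret S: group "SYM Q" by (rule group_BijGroup)
  note x = assms(5) and \<psi> = assms(6)
  note x' = inv_closed[OF x]
  obtain f g where f: "f \<in> carrier Q" and g: "g \<in> carrier Q"
    and BS: "(inv\<^bsub>SYM Q\<^esub> (rmul Q g) \<otimes>\<^bsub>SYM Q\<^esub> \<alpha>, inv\<^bsub>SYM Q\<^esub> (lmul Q f) \<otimes>\<^bsub>SYM Q\<^esub> \<alpha>, \<alpha>) \<in> AUT Q"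
    using assms(4) by (auto simp: BS_def)
  note s = sigma_closed[OF inv_closed[OF g]] and t = sigma_closed[OF x']
  note Rx = rmul_in_SYM[OF x] and Rg = rmul_in_SYM[OF g] and Rx' = rmul_in_SYM[OF x']
    and Rs = rmul_in_SYM[OF s] and Rt = rmul_in_SYM[OF t]
  have \<alpha>: "\<alpha> \<in> carrier (SYM Q)"
    using assms(4) by (simp add: BS_def)
  have "rmul Q g \<otimes>\<^bsub>SYM Q\<^esub> (inv\<^bsub>SYM Q\<^esub> (rmul Q g) \<otimes>\<^bsub>SYM Q\<^esub> \<alpha>) = \<alpha>"
    using Rg \<alpha> by (simp add: S.m_assoc[symmetric])
  moreover have "rmul Q x \<otimes>\<^bsub>SYM Q\<^esub> \<alpha> = \<psi>"
    unfolding assms(8) using Rx \<psi> by (simp add: S.m_assoc[symmetric])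
  ultimately obtain B where
    T: "(\<psi>, B, rmul Q (\<sigma> (inv x)) \<otimes>\<^bsub>SYM Q\<^esub> (rmul Q (\<sigma> (inv g)) \<otimes>\<^bsub>SYM Q\<^esub> \<alpha>)) \<in> AUT Q"
    using AUT_mult[OF AUT_mult[OF BS bol_autotopism[OF g]] bol_autotopism[OF x]] by auto
  have "\<alpha> \<one> = inv x"
    unfolding assms(8) inv_rmul[OF x]
    by (simp add: SYM_mult_apply[OF Rx' \<psi> one_closed] assms(7) rmul_apply one_closed l_one x')
  then have "(rmul Q (\<sigma> (inv x)) \<otimes>\<^bsub>SYM Q\<^esub> (rmul Q (\<sigma> (inv g)) \<otimes>\<^bsub>SYM Q\<^esub> \<alpha>)) \<one>
      = (inv x \<otimes> \<sigma> (inv g)) \<otimes> \<sigma> (inv x)"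
    using Rs Rt \<alpha> s x' by (simp add: SYM_mult_apply one_closed rmul_apply m_closed)
  also have "\<dots> = (inv x \<otimes> inv (\<sigma> g)) \<otimes> inv (\<sigma> x)"
    using assms(2) x g by simp
  finally have "pseudo_automorphism Q \<psi> ((inv x \<otimes> inv (\<sigma> g)) \<otimes> inv (\<sigma> x))"
    using autotopism_fixing_one_is_pseudo_automorphism[OF T assms(7)] by simp
  then have "\<exists>g\<in>carrier Q. pseudo_automorphism Q \<psi> ((inv x \<otimes> inv g) \<otimes> inv (\<sigma> x))"
    using sigma_closed[OF g] by blast
  moreover have "\<psi>' = \<psi>"
    if "y \<in> carrier Q" "\<psi>' \<in> carrier (SYM Q)" "\<psi>' \<one> = \<one>"
      "\<alpha> = inv\<^bsub>SYM Q\<^esub> (rmul Q y) \<otimes>\<^bsub>SYM Q\<^esub> \<psi>'" for y \<psi>'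
    using translation_factorisation_unique[OF x that(1) \<psi> that(2) assms(7) that(3)]
      that(4) assms(8) by simp
  ultimately show ?thesis by blast
qed

end
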